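(* Let $1<p<q<\infty$. Then $\mathcal E^p\subset\mathcal E^q$ continuously. More precisely, there exists a constant $C_{p,q}>0$ such that $$\|f\|_{\mathcal E^q}\le C_{p,q}\|f\|_{\mathcal E^p},\qquad f\in\mathcal E^p.$$ Furthermore, the inclusion is strict.
   Context: $C([0,1])$ denotes the real-valued continuous functions on $[0,1]$, $\|\cdot\|_\infty$ the uniform norm. $\mathbb N_0=\{0,1,2,\dots\}$, $\mathbb N_{-1}=\{-1,0,1,\dots\}$. For $n\in\mathbb N_0$: $t_{n,k}=k2^{-n}$ for $0\le k\le 2^n$, $I_n=\{0,\dots,2^n-1\}$. Faber--Schauder coefficients of $f\in C([0,1])$: $\theta^f_{-1,0}=f(1)-f(0)$, and for $n\ge0$, $k\in I_n$, $\theta^f_{n,k}=2^{n/2}\big(2f(t_{n+1,2k+1})-f(t_{n,k})-f(t_{n,k+1})\big)$. Level energies ($p>1$): $\zeta_f^{(p)}=(\zeta_f^{(p)}(n))_{n\in\mathbb N_{-1}}$ with $\zeta_f^{(p)}(-1)=2^{1-\frac1p}|\theta^f_{-1,0}|$ and $\zeta_f^{(p)}(n)=\big(2^{-np/2}\sum_{k\in I_n}|\theta^f_{n,k}|^p\big)^{1/p}$ for $n\ge0$. Schauder tail sequence: $H_f(n)=\sum_{m=n}^\infty 2^{-m/2}\sup_{k\in I_m}|\theta^f_{m,k}|\in[0,\infty]$ for $n\ge0$. Energy space ($p>1$): $\|f\|_{\mathcal E^p}=\|f\|_\infty+\|\zeta_f^{(p)}\|_{\ell^p(\mathbb N_{-1})}+\|H_f\|_{\ell^p(\mathbb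 N_0)}$ and $\mathcal E^p=\{f\in C([0,1]):\|f\|_{\mathcal E^p}<\infty\}$. *)

theory Defs
  imports "HOL-Analysis.Analysis"
begin

(* Extensionality (the value undefined off [0,1]) makes the elements correspond one-to-one
   to the real-valued continuous functions with domain [0,1]. *)
definition C01 :: "(real \<Rightarrow> real) set"
  where "C01 = {f \<in> extensional {0..1}. continuous_on {0..1} f}"

definition sup_norm :: "(real \<Rightarrow> real) \<Rightarrow> ennreal"
  where "sup_norm f = (SUP x\<in>{0..1}. ennreal \<bar>f x\<bar>)"

(* Levels are integers, so that the index sets N_{-1} and N_0 are {-1..} and {0..}. *)
definition dyadic :: "int \<Rightarrow> nat \<Rightarrow> real"
  where "dyadic n k = real k * 2 powi (- n)"

definition level_index :: "int \<Rightarrow> nat set"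
  where "level_index n = {..<2 ^ nat n}"

(* Meaningful for n = -1, k = 0 and for n >= 0, k in level_index n. *)
definition schauder_coeff :: "(real \<Rightarrow> real) \<Rightarrow> int \<Rightarrow> nat \<Rightarrow> real"
  where "schauder_coeff f n k =
    (if n = -1 then f 1 - f 0
     else 2 powr (real_of_int n / 2) *
       (2 * f (dyadic (n + 1) (2 * k + 1)) - f (dyadic n k) - f (dyadic n (k + 1))))"

definition level_energy :: "real \<Rightarrow> (real \<Rightarrow> real) \<Rightarrow> int \<Rightarrow> real"
  where "level_energy p f n =
    (if n = -1 then 2 powr (1 - 1 / p) * \<bar>schauder_coeff f (-1) 0\<bar>
     else (2 powr (- (real_of_int n * p / 2)) *
       (\<Sum>k\<in>level_index n. \<bar>schauder_coeff f n k\<bar> powr p)) powr (1 / p))"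

definition schauder_tail :: "(real \<Rightarrow> real) \<Rightarrow> int \<Rightarrow> ennreal"
  where "schauder_tail f n =
    (\<Sum>\<^sub>\<infinity>m\<in>{n..}. ennreal (2 powr (- (real_of_int m / 2))) *
       (SUP k\<in>level_index m. ennreal \<bar>schauder_coeff f m k\<bar>))"

(* The power x^r on [0,\<infinity>], only used for r > 0. *)
definition ennreal_powr :: "ennreal \<Rightarrow> real \<Rightarrow> ennreal"
  where "ennreal_powr x r = (if x = \<infinity> then \<infinity> else ennreal (enn2real x powr r))"

definition lp_norm :: "real \<Rightarrow> 'i set \<Rightarrow> ('i \<Rightarrow> ennreal) \<Rightarrow> ennreal"
  where "lp_norm p A a = ennreal_powr (\<Sum>\<^sub>\<infinity>i\<in>A. ennreal_powr (a i) p) (1 / p)"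

definition energy_norm :: "real \<Rightarrow> (real \<Rightarrow> real) \<Rightarrow> ennreal"
  where "energy_norm p f =
    sup_norm f + lp_norm p {-1..} (\<lambda>n. ennreal (level_energy p f n))
      + lp_norm p {0..} (schauder_tail f)"

definition energy_space :: "real \<Rightarrow> (real \<Rightarrow> real) set"
  where "energy_space p = {f \<in> C01. energy_norm p f < \<infinity>}"

end

theory Submission
  imports Defs
begin

text \<open>
  The inclusion comes from the fact that the \<open>\<ell>\<^sup>q\<close> norm of any family is at most its \<open>\<ell>\<^sup>p\<close> norm
  (\<open>lp_norm_antimono_exponent\<close>). For \<open>n \<ge> 0\<close> the level energy is itself an \<open>\<ell>\<^sup>p\<close> norm, namely that of
  the second differences \<open>2\<^bsup>-n/2\<^esup>\<bar>\<theta>\<^sub>n\<^sub>,\<^sub>k\<bar>\<close> over \<open>k\<close>, so the comparison applies twice: to the sum over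
  \<open>k\<close> on each level and then to the sequence of levels. Only the level \<open>-1\<close> can grow with the exponent,
  because of its prefactor \<open>2\<^bsup>1-1/p\<^esup>\<close>, which lies between \<open>1\<close> and \<open>2\<close>. The tail sequence does not
  involve the exponent, and the outer comparison covers it. The constant \<open>2\<close> therefore works.

  The inclusion is strict because of the Takagi function \<open>\<Sum>\<^sub>m r\<^sup>m dist(2\<^sup>m x, \<int>)\<close> with
  \<open>r = 2\<^bsup>-1/p\<^esup>\<close>. Its second difference over every dyadic interval of level \<open>n\<close> is exactly \<open>r\<^sup>n\<close>
  (\<open>dist_to_Ints_second_difference\<close>). There are \<open>2\<^sup>n\<close> such intervals, so the \<open>s\<close>-energy of level \<open>n\<close>
  is \<open>(2\<^bsup>1/s\<^esup>r)\<^sup>n\<close>, which is constantly \<open>1\<close> for \<open>s = p\<close> and decays geometrically for \<open>s = q\<close>.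
  The tail sequence decays like \<open>r\<^sup>n\<close>. Hence the function lies in the space of exponent \<open>q\<close> but
  not in that of exponent \<open>p\<close>.
\<close>

section \<open>Powers and sequence norms on the extended half-line\<close>

lemma ennreal_powr_ennreal:
  assumes "0 \<le> x"
  shows "ennreal_powr (ennreal x) r = ennreal (x powr r)"
  using assms by (simp add: ennreal_powr_def)

lemma ennreal_powr_top [simp]: "ennreal_powr top r = top"
  by (simp add: ennreal_powr_def)

lemma ennreal_powr_one [simp]: "ennreal_powr x 1 = x"
  by (cases x rule: ennreal_cases) (simp_all add: ennreal_powr_ennreal)

lemma ennreal_powr_mono:
  assumes "x \<le> y" and "0 \<le> r"
  shows "ennreal_powr x r \<le> ennreal_powr y r"
  using assms
  by (cases x rule: ennreal_cases; cases y rule: ennreal_cases)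
    (auto simp: ennreal_powr_ennreal top_unique intro!: ennreal_leI powr_mono2)

text \<open>
  Multiplicativity includes the product of \<open>0\<close> and \<open>\<infinity>\<close>: it is \<open>0\<close>, as is its power, since \<open>r > 0\<close>.
\<close>

lemma ennreal_powr_mult:
  assumes "0 < r"
  shows "ennreal_powr (x * y) r = ennreal_powr x r * ennreal_powr y r"
proof (cases x rule: ennreal_cases)
  case x: (real a)
  show ?thesis
  proof (cases y rule: ennreal_cases)
    case (real b)
    with x show ?thesis
      by (simp add: ennreal_powr_ennreal powr_mult flip: ennreal_mult)
  next
    case top
    with x assms show ?thesis
      by (cases "a = 0") (auto simp: ennreal_powr_ennreal ennreal_mult_top ennreal_powr_def)
  qed
next
  case top
  then show ?thesis
    using assms
    by (cases y rule: ennreal_cases; cases "y = 0")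
      (auto simp: ennreal_powr_ennreal ennreal_top_mult ennreal_powr_def)
qed

lemma ennreal_powr_add:
  assumes "0 < r" and "0 < s"
  shows "ennreal_powr x (r + s) = ennreal_powr x r * ennreal_powr x s"
  using assms
  by (cases x rule: ennreal_cases) (auto simp: ennreal_powr_ennreal powr_add ennreal_mult)

lemma ennreal_powr_powr: "ennreal_powr (ennreal_powr x r) s = ennreal_powr x (r * s)"
  by (cases x rule: ennreal_cases) (auto simp: ennreal_powr_ennreal powr_powr)

text \<open>
  An infinite sum in \<open>[0,\<infinity>]\<close> is the supremum of its finite partial sums, and multiplication by a constant
  of \<open>[0,\<infinity>]\<close> commutes with suprema.
\<close>

lemma infsum_cmult_ennreal: "(\<Sum>\<^sub>\<infinity>i\<in>A. c * f i) = c * (\<Sum>\<^sub>\<infinity>i\<in>A. f i)" for c :: ennreal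
  by (simp add: nonneg_infsum_complete SUP_mult_left_ennreal sum_distrib_left)

lemma infsum_ge_term_ennreal:
  fixes f :: "'i \<Rightarrow> ennreal"
  assumes "i \<in> A"
  shows "f i \<le> infsum f A"
  unfolding nonneg_infsum_complete[OF zero_le]
  using assms by (intro SUP_upper2[of "{i}"]) auto

lemma lp_norm_mono:
  assumes "\<And>i. i \<in> A \<Longrightarrow> a i \<le> b i" and "0 < p"
  shows "lp_norm p A a \<le> lp_norm p A b"
  unfolding lp_norm_def using assms
  by (intro ennreal_powr_mono infsum_mono nonneg_summable_on_complete) auto

lemma lp_norm_cmult:
  assumes "0 < p"
  shows "lp_norm p A (\<lambda>i. c * a i) = c * lp_norm p A a"
  using assms
  by (simp add: lp_norm_def ennreal_powr_mult infsum_cmult_ennreal ennreal_powr_powr)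

text \<open>
  With \<open>L\<close> the \<open>\<ell>\<^sup>p\<close> norm, every term satisfies \<open>a i \<le> L\<close>, so \<open>(a i)\<^sup>q \<le> L\<^bsup>q-p\<^esup>(a i)\<^sup>p\<close>.
  Summation gives \<open>L\<^bsup>q-p\<^esup>L\<^sup>p = L\<^sup>q\<close>. No division by \<open>L\<close> occurs, hence the values \<open>0\<close> and \<open>\<infinity>\<close> of
  \<open>L\<close> do not have to be separated.
\<close>

lemma lp_norm_antimono_exponent:
  assumes "0 < p" and "p < q"
  shows "lp_norm q A a \<le> lp_norm p A a"
proof -
  define S where "S = (\<Sum>\<^sub>\<infinity>i\<in>A. ennreal_powr (a i) p)"
  define L where "L = lp_norm p A a"
  have L: "L = ennreal_powr S (1 / p)"
    by (simp add: L_def S_def lp_norm_def)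
  have S: "S = ennreal_powr L p"
    using assms by (simp add: L ennreal_powr_powr)
  have le: "a i \<le> L" if "i \<in> A" for i
  proof -
    have "ennreal_powr (a i) p \<le> S"
      unfolding S_def by (rule infsum_ge_term_ennreal[OF that])
    then have "ennreal_powr (ennreal_powr (a i) p) (1 / p) \<le> ennreal_powr S (1 / p)"
      using assms by (intro ennreal_powr_mono) auto
    then show ?thesis
      using assms by (simp add: L ennreal_powr_powr)
  qed
  have "ennreal_powr (a i) q \<le> ennreal_powr L (q - p) * ennreal_powr (a i) p" if "i \<in> A" for i
  proof -
    have "ennreal_powr (a i) q = ennreal_powr (a i) (q - p) * ennreal_powr (a i) p"
      using ennreal_powr_add[of "q - p" p "a i"] assms by simp
    also have "\<dots> \<le> ennreal_powr L (q - p) * ennreal_powr (a i) p"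
      using assms le[OF that] by (intro mult_right_mono ennreal_powr_mono) auto
    finally show ?thesis .
  qed
  then have "(\<Sum>\<^sub>\<infinity>i\<in>A. ennreal_powr (a i) q)
      \<le> (\<Sum>\<^sub>\<infinity>i\<in>A. ennreal_powr L (q - p) * ennreal_powr (a i) p)"
    by (intro infsum_mono nonneg_summable_on_complete) auto
  also have "\<dots> = ennreal_powr L (q - p) * ennreal_powr L p"
    by (simp add: infsum_cmult_ennreal S flip: S_def)
  also have "\<dots> = ennreal_powr L q"
    using ennreal_powr_add[of "q - p" p L] assms by simp
  finally have "lp_norm q A a \<le> ennreal_powr (ennreal_powr L q) (1 / q)"
    unfolding lp_norm_def using assms by (intro ennreal_powr_mono) auto
  then show ?thesis
    using assms by (simp add: ennreal_powr_powr flip: L_def)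
qed

lemma infsum_geometric_atLeast:
  fixes \<rho> c :: real and N :: int
  assumes "0 < \<rho>" and "\<rho> < 1" and "0 \<le> c"
  shows "(\<Sum>\<^sub>\<infinity>n\<in>{N..}. ennreal (c * \<rho> powi n)) = ennreal (c * \<rho> powi N / (1 - \<rho>))"
proof -
  have bij: "bij_betw (\<lambda>j. N + int j) UNIV {N..}"
    by (rule bij_betwI[where g = "\<lambda>n. nat (n - N)"]) auto
  have "(\<lambda>j. c * \<rho> powi N * \<rho> ^ j) sums (c * \<rho> powi N * (1 / (1 - \<rho>)))"
    using assms by (intro sums_mult geometric_sums) auto
  then have sums: "(\<lambda>j. c * \<rho> powi (N + int j)) sums (c * \<rho> powi N / (1 - \<rho>))"
    using assms by (simp add: power_int_add mult.assoc)
  have "(\<Sum>\<^sub>\<infinity>n\<in>{N..}. ennreal (c * \<rho> powi n)) = (\<Sum>\<^sub>\<infinity>j. ennreal (c * \<rho> powi (N + int j)))"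
    by (rule infsum_reindex_bij_betw[OF bij, symmetric])
  also have "\<dots> = (\<Sum>j. ennreal (c * \<rho> powi (N + int j)))"
    by (rule sums_unique[OF has_sum_imp_sums[OF has_sum_infsum]]) (rule nonneg_summable_on_complete, simp)
  also have "\<dots> = ennreal (c * \<rho> powi N / (1 - \<rho>))"
    using assms by (intro suminf_ennreal_eq sums) auto
  finally show ?thesis .
qed

text \<open>
  By the comparison of exponents it is enough to bound the \<open>\<ell>\<^sup>1\<close> norm, which is a geometric series.
\<close>

lemma lp_norm_geometric_finite:
  fixes \<rho> c p :: real and N :: int
  assumes "0 < \<rho>" and "\<rho> < 1" and "0 \<le> c" and "1 < p"
    and "\<And>n. N \<le> n \<Longrightarrow> a n \<le> ennreal (c * \<rho> powi n)"
  shows "lp_norm p {N..} a < \<infinity>"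
proof -
  have "lp_norm p {N..} a \<le> lp_norm p {N..} (\<lambda>n. ennreal (c * \<rho> powi n))"
    using assms by (intro lp_norm_mono) auto
  also have "\<dots> \<le> lp_norm 1 {N..} (\<lambda>n. ennreal (c * \<rho> powi n))"
    using assms by (intro lp_norm_antimono_exponent) auto
  also have "\<dots> = ennreal (c * \<rho> powi N / (1 - \<rho>))"
    by (simp add: lp_norm_def infsum_geometric_atLeast assms(1-3))
  also have "\<dots> < \<infinity>"
    by simp
  finally show ?thesis .
qed

section \<open>Monotonicity of the energy norm in the exponent\<close>

text \<open>
  Moving the factor \<open>2\<^bsup>-np/2\<^esup>\<close> into the sum turns the coefficients into the second differences of \<open>f\<close>,
  which are independent of \<open>p\<close>. This is what makes energies of different exponents comparable.
\<close>

lemma level_energy_eq_lp_norm: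
  assumes "0 < p" and "0 \<le> n"
  shows "ennreal (level_energy p f n) =
    lp_norm p (level_index n) (\<lambda>k. ennreal (2 powr (- (real_of_int n / 2)) * \<bar>schauder_coeff f n k\<bar>))"
proof -
  have "(\<Sum>k\<in>level_index n. (2 powr (- (real_of_int n / 2)) * \<bar>schauder_coeff f n k\<bar>) powr p)
      = 2 powr (- (real_of_int n * p / 2)) * (\<Sum>k\<in>level_index n. \<bar>schauder_coeff f n k\<bar> powr p)"
    by (simp add: powr_mult powr_powr sum_distrib_left)
  then show ?thesis
    using assms
    by (simp add: lp_norm_def level_energy_def ennreal_powr_ennreal sum_nonneg level_index_def)
qed

lemma level_energy_le:
  assumes "1 < p" and "p < q" and "-1 \<le> n"
  shows "ennreal (level_energy q f n) \<le> 2 * ennreal (level_energy p f n)"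
proof (cases "n = -1")
  case True
  have "0 \<le> 1 / q" "1 / p \<le> 1"
    using assms by auto
  then have "1 - 1 / q \<le> 1 + (1 - 1 / p)"
    by linarith
  then have "(2::real) powr (1 - 1 / q) \<le> 2 powr (1 + (1 - 1 / p))"
    by (intro powr_mono) auto
  then have "2 powr (1 - 1 / q) * \<bar>schauder_coeff f (-1) 0\<bar>
      \<le> 2 * (2 powr (1 - 1 / p) * \<bar>schauder_coeff f (-1) 0\<bar>)"
    unfolding powr_add mult.assoc[symmetric] by (intro mult_right_mono) auto
  then have "ennreal (level_energy q f n) \<le> ennreal (2 * level_energy p f n)"
    using True by (intro ennreal_leI) (simp add: level_energy_def)
  then show ?thesis
    using True by (simp add: ennreal_mult level_energy_def)
next
  case False
  then have n: "0 \<le> n"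
    using assms by simp
  have "ennreal (level_energy q f n) \<le> ennreal (level_energy p f n)"
    using assms n by (simp add: level_energy_eq_lp_norm lp_norm_antimono_exponent)
  also have "\<dots> \<le> 2 * ennreal (level_energy p f n)"
    by (simp add: mult_2)
  finally show ?thesis .
qed

lemma energy_norm_le:
  assumes "1 < p" and "p < q"
  shows "energy_norm q f \<le> 2 * energy_norm p f"
proof -
  have "lp_norm q {-1..} (\<lambda>n. ennreal (level_energy q f n))
      \<le> lp_norm q {-1..} (\<lambda>n. 2 * ennreal (level_energy p f n))"
    using assms by (intro lp_norm_mono level_energy_le) auto
  also have "\<dots> = 2 * lp_norm q {-1..} (\<lambda>n. ennreal (level_energy p f n))"
    using assms by (intro lp_norm_cmult) auto
  also have "\<dots> \<le> 2 * lp_norm p {-1..} (\<lambda>n. ennreal (level_energy p f n))"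
    using assms by (intro mult_left_mono lp_norm_antimono_exponent) auto
  finally have energies: "lp_norm q {-1..} (\<lambda>n. ennreal (level_energy q f n))
      \<le> 2 * lp_norm p {-1..} (\<lambda>n. ennreal (level_energy p f n))" .
  have "lp_norm q {0..} (schauder_tail f) \<le> lp_norm p {0..} (schauder_tail f)"
    using assms by (intro lp_norm_antimono_exponent) auto
  then have tails: "lp_norm q {0..} (schauder_tail f) \<le> 2 * lp_norm p {0..} (schauder_tail f)"
    by (rule order_trans) (simp add: mult_2)
  have "sup_norm f \<le> 2 * sup_norm f"
    by (simp add: mult_2)
  then show ?thesis
    unfolding energy_norm_def distrib_left by (intro add_mono energies tails)
qed

section \<open>The triangle wave\<close>

text \<open>
  Writing the triangle wave as a distance function makes its continuity immediate; its piecewise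
  linear shape follows from \<open>dist_to_Ints_eq\<close>.
\<close>

definition dist_to_Ints :: "real \<Rightarrow> real"
  where "dist_to_Ints x = infdist x \<int>"

lemma continuous_on_dist_to_Ints [continuous_intros]:
  assumes "continuous_on S g"
  shows "continuous_on S (\<lambda>x. dist_to_Ints (g x))"
  unfolding dist_to_Ints_def by (intro continuous_on_infdist assms)

lemma dist_to_Ints_nonneg: "0 \<le> dist_to_Ints x"
  by (simp add: dist_to_Ints_def infdist_nonneg)

lemma dist_to_Ints_eq:
  assumes "\<bar>x - of_int j\<bar> \<le> 1 / 2"
  shows "dist_to_Ints x = \<bar>x - of_int j\<bar>"
proof (rule antisym)
  show "dist_to_Ints x \<le> \<bar>x - of_int j\<bar>"
    using infdist_le[of "of_int j :: real" \<int> x] by (simp add: dist_to_Ints_def dist_real_def)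
  have "\<bar>x - of_int j\<bar> \<le> dist x a" if a: "a \<in> \<int>" for a
  proof -
    obtain i where i: "a = of_int i"
      using a by (auto elim: Ints_cases)
    show ?thesis
    proof (cases "i = j")
      case False
      then have "1 \<le> \<bar>i - j\<bar>"
        by simp
      then have "1 \<le> \<bar>real_of_int i - of_int j\<bar>"
        by linarith
      then show ?thesis
        unfolding i dist_real_def using assms by linarith
    qed (simp add: i dist_real_def)
  qed
  moreover have "(\<int> :: real set) \<noteq> {}"
    by blast
  ultimately show "\<bar>x - of_int j\<bar> \<le> dist_to_Ints x"
    by (auto simp: dist_to_Ints_def infdist_notempty intro!: cINF_greatest)
qed

lemma dist_to_Ints_le: "dist_to_Ints x \<le> 1 / 2"
  using dist_to_Ints_eq[of x "round x"] of_int_round_abs_le[of x]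
  by (simp add: abs_minus_commute)

lemma dist_to_Ints_of_int [simp]: "dist_to_Ints (of_int j) = 0"
  using dist_to_Ints_eq[of "of_int j" j] by simp

lemma dist_to_Ints_of_nat [simp]: "dist_to_Ints (of_nat j) = 0"
  using dist_to_Ints_of_int[of "int j"] by simp

lemma dist_to_Ints_affine_on_half_intervals:
  fixes j :: nat
  obtains a b where "\<And>x. x \<in> {real j / 2..(real j + 1) / 2} \<Longrightarrow> dist_to_Ints x = a * x + b"
proof (cases "even j")
  case True
  then obtain i where i: "j = 2 * i"
    by (rule evenE)
  have "dist_to_Ints x = 1 * x + (- real i)" if "x \<in> {real j / 2..(real j + 1) / 2}" for x
    using dist_to_Ints_eq[of x "int i"] that by (auto simp: i)
  then show ?thesis
    by (rule that)
next
  case False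
  then obtain i where i: "j = 2 * i + 1"
    by (rule oddE)
  have "dist_to_Ints x = (-1) * x + (real i + 1)" if "x \<in> {real j / 2..(real j + 1) / 2}" for x
    using dist_to_Ints_eq[of x "int i + 1"] that by (auto simp: i add_divide_distrib)
  then show ?thesis
    by (rule that)
qed

text \<open>
  The wave of frequency \<open>2\<^sup>m\<close> is invisible to second differences of every level \<open>n \<noteq> m\<close>. If \<open>m > n\<close>, the
  three sample points become integers, where the wave vanishes. If \<open>m < n\<close>, they lie in one
  half-interval \<open>[j/2,(j+1)/2]\<close>, on which the wave is affine. If \<open>m = n\<close>, they are \<open>k\<close>,
  \<open>k + 1/2\<close> and \<open>k + 1\<close>, and only the peak at \<open>k + 1/2\<close> contributes.
\<close>

lemma dist_to_Ints_second_difference: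
  fixes m n k :: nat
  shows "2 * dist_to_Ints (2 ^ m * (real (2 * k + 1) / 2 ^ (n + 1)))
      - dist_to_Ints (2 ^ m * (real k / 2 ^ n)) - dist_to_Ints (2 ^ m * (real (k + 1) / 2 ^ n))
    = (if m = n then 1 else 0)"
proof (rule linorder_cases[of m n])
  assume "n < m"
  then obtain d where d: "m = n + 1 + d"
    using less_iff_Suc_add by auto
  have args: "2 ^ m * (real (2 * k + 1) / 2 ^ (n + 1)) = real (2 ^ d * (2 * k + 1))"
    "2 ^ m * (real k / 2 ^ n) = real (2 ^ (d + 1) * k)"
    "2 ^ m * (real (k + 1) / 2 ^ n) = real (2 ^ (d + 1) * (k + 1))"
    unfolding d by (simp_all add: power_add field_simps)
  show ?thesis
    unfolding args dist_to_Ints_of_nat using \<open>n < m\<close> by simp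
next
  assume "m = n"
  moreover have "dist_to_Ints (real k + 1 / 2) = 1 / 2"
    using dist_to_Ints_eq[of "real k + 1 / 2" "int k"] by simp
  moreover have "2 ^ n * (real (2 * k + 1) / 2 ^ (n + 1)) = real k + 1 / 2"
    by (simp add: field_simps)
  moreover have "2 ^ n * (real k / 2 ^ n) = real k" "2 ^ n * (real (k + 1) / 2 ^ n) = real (k + 1)"
    by simp_all
  ultimately show ?thesis
    by (simp only: dist_to_Ints_of_nat) simp
next
  assume "m < n"
  then obtain d where d: "n = m + 1 + d"
    using less_iff_Suc_add by auto
  \<comment> \<open>After scaling, a dyadic interval of level \<open>n\<close> has length \<open>1/(2M)\<close>, so half-intervals split into \<open>M\<close> of them.\<close>
  define M :: nat where "M = 2 ^ d"
  define j where "j = k div M"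
  have M: "0 < M"
    by (simp add: M_def)
  have "j * M \<le> k" "k + 1 \<le> (j + 1) * M"
    using M dividend_less_div_times[of M k] by (simp_all add: j_def Suc_le_eq)
  then have "real (j * M) \<le> real k" "real (k + 1) \<le> real ((j + 1) * M)"
    by (simp_all only: of_nat_le_iff)
  then have j: "real j * real M \<le> real k" "real k + 1 \<le> (real j + 1) * real M"
    by (simp_all add: algebra_simps)
  have args: "2 ^ m * (real (2 * k + 1) / 2 ^ (n + 1)) = (2 * real k + 1) / (4 * real M)"
    "2 ^ m * (real k / 2 ^ n) = real k / (2 * real M)"
    "2 ^ m * (real (k + 1) / 2 ^ n) = (real k + 1) / (2 * real M)"
    unfolding d M_def by (simp_all add: power_add field_simps)
  obtain a b where ab: "\<And>x. x \<in> {real j / 2..(real j + 1) / 2} \<Longrightarrow> dist_to_Ints x = a * x + b"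
    using dist_to_Ints_affine_on_half_intervals[of j] by blast
  have "(2 * real k + 1) / (4 * real M) \<in> {real j / 2..(real j + 1) / 2}"
    "real k / (2 * real M) \<in> {real j / 2..(real j + 1) / 2}"
    "(real k + 1) / (2 * real M) \<in> {real j / 2..(real j + 1) / 2}"
    using j M by (auto simp: field_simps)
  then have "2 * dist_to_Ints ((2 * real k + 1) / (4 * real M)) - dist_to_Ints (real k / (2 * real M))
      - dist_to_Ints ((real k + 1) / (2 * real M)) = 0"
    using M by (simp add: ab field_simps)
  then show ?thesis
    using \<open>m < n\<close> by (simp only: args) simp
qed

section \<open>A Takagi function separating the energy spaces\<close>

definition takagi :: "real \<Rightarrow> real \<Rightarrow> real"
  where "takagi r = (\<lambda>x\<in>{0..1}. \<Sum>m. r ^ m * dist_to_Ints (2 ^ m * x))"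

lemma takagi_term_bound:
  assumes "0 < r"
  shows "norm (r ^ m * dist_to_Ints (2 ^ m * x)) \<le> r ^ m"
proof -
  have "r ^ m * dist_to_Ints (2 ^ m * x) \<le> r ^ m * 1"
    using assms dist_to_Ints_le[of "2 ^ m * x"] by (intro mult_left_mono) auto
  then show ?thesis
    using assms by (simp add: dist_to_Ints_nonneg)
qed

lemma takagi_sums:
  assumes "0 < r" and "r < 1" and "x \<in> {0..1}"
  shows "(\<lambda>m. r ^ m * dist_to_Ints (2 ^ m * x)) sums takagi r x"
proof -
  have "summable (\<lambda>m. r ^ m * dist_to_Ints (2 ^ m * x))"
    by (rule summable_comparison_test'[OF summable_geometric[of r] takagi_term_bound])
      (use assms in auto)
  then show ?thesis
    using assms by (simp add: takagi_def summable_sums)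
qed

lemma takagi_in_C01:
  assumes "0 < r" and "r < 1"
  shows "takagi r \<in> C01"
proof -
  have "uniform_limit {0..1} (\<lambda>n x. \<Sum>m<n. r ^ m * dist_to_Ints (2 ^ m * x))
      (\<lambda>x. \<Sum>m. r ^ m * dist_to_Ints (2 ^ m * x)) sequentially"
    by (rule Weierstrass_m_test[OF takagi_term_bound]) (use assms in auto)
  then have "continuous_on {0..1} (\<lambda>x. \<Sum>m. r ^ m * dist_to_Ints (2 ^ m * x))"
    by (rule uniform_limit_theorem[rotated]) (auto intro!: always_eventually continuous_intros)
  then have "continuous_on {0..1} (takagi r)"
    by (rule continuous_on_eq) (simp add: takagi_def)
  then show ?thesis
    by (simp add: C01_def takagi_def)
qed

lemma dyadic_of_nat: "dyadic (int n) k = real k / 2 ^ n"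
  by (simp add: dyadic_def power_int_minus divide_inverse)

lemma dyadic_in_unit_interval:
  assumes "k \<le> 2 ^ n"
  shows "real k / 2 ^ n \<in> {0..1}"
proof -
  have "real k \<le> real (2 ^ n)"
    using assms by (simp only: of_nat_le_iff)
  then show ?thesis
    by simp
qed

text \<open>
  Second differences act term by term on the series, and only the term \<open>m = n\<close> survives; the value
  does not depend on the position \<open>k\<close>.
\<close>

lemma schauder_coeff_takagi:
  assumes "0 < r" and "r < 1" and "k \<in> level_index n" and "0 \<le> n"
  shows "2 powr (- (real_of_int n / 2)) * \<bar>schauder_coeff (takagi r) n k\<bar> = r powi n"
proof -
  obtain N where n: "n = int N"
    using assms(4) nonneg_int_cases by blast
  have k: "k + 1 \<le> 2 ^ N"
    using assms(3) by (simp add: level_index_def n)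
  define l c u where "l = real k / 2 ^ N" and "c = real (2 * k + 1) / 2 ^ (N + 1)"
    and "u = real (k + 1) / 2 ^ N"
  have dom: "l \<in> {0..1}" "c \<in> {0..1}" "u \<in> {0..1}"
    unfolding l_def c_def u_def by (rule dyadic_in_unit_interval; use k in simp)+
  have "(\<lambda>m. 2 * (r ^ m * dist_to_Ints (2 ^ m * c)) - r ^ m * dist_to_Ints (2 ^ m * l)
      - r ^ m * dist_to_Ints (2 ^ m * u)) sums (2 * takagi r c - takagi r l - takagi r u)"
    by (intro sums_diff sums_mult takagi_sums assms dom)
  moreover have "2 * (r ^ m * dist_to_Ints (2 ^ m * c)) - r ^ m * dist_to_Ints (2 ^ m * l)
      - r ^ m * dist_to_Ints (2 ^ m * u) = (if m = N then r ^ m else 0)" for m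
  proof -
    have "2 * (r ^ m * dist_to_Ints (2 ^ m * c)) - r ^ m * dist_to_Ints (2 ^ m * l)
        - r ^ m * dist_to_Ints (2 ^ m * u)
      = r ^ m * (2 * dist_to_Ints (2 ^ m * c) - dist_to_Ints (2 ^ m * l) - dist_to_Ints (2 ^ m * u))"
      by (simp add: algebra_simps)
    then show ?thesis
      unfolding l_def c_def u_def dist_to_Ints_second_difference by simp
  qed
  ultimately have "(\<lambda>m. if m = N then r ^ m else 0) sums (2 * takagi r c - takagi r l - takagi r u)"
    by simp
  then have D: "2 * takagi r c - takagi r l - takagi r u = r ^ N"
    using sums_single[of N "\<lambda>m. r ^ m"] sums_unique2 by blast
  have "dyadic (n + 1) (2 * k + 1) = c" "dyadic n k = l" "dyadic n (k + 1) = u"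
    using dyadic_of_nat[of "N + 1" "2 * k + 1"] dyadic_of_nat[of N k] dyadic_of_nat[of N "k + 1"]
    by (simp_all add: n l_def c_def u_def add.commute)
  then have "schauder_coeff (takagi r) n k = 2 powr (real_of_int n / 2) * r ^ N"
    using D by (simp add: schauder_coeff_def n)
  then show ?thesis
    using assms by (simp add: abs_mult n flip: mult.assoc powr_add)
qed

lemma level_energy_takagi:
  assumes "0 < r" and "r < 1" and "0 < p" and "0 \<le> n"
  shows "level_energy p (takagi r) n = (2 powr (1 / p) * r) powi n"
proof -
  obtain N where n: "n = int N"
    using assms(4) nonneg_int_cases by blast
  have "ennreal (level_energy p (takagi r) n) = lp_norm p (level_index n) (\<lambda>k. ennreal (r powi n))"
    using assms unfolding level_energy_eq_lp_norm[OF assms(3,4)] lp_norm_def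
    by (simp add: schauder_coeff_takagi cong: infsum_cong)
  also have "\<dots> = ennreal ((2 ^ N * (r ^ N) powr p) powr (1 / p))"
  proof -
    have "(\<Sum>\<^sub>\<infinity>k\<in>level_index n. ennreal_powr (ennreal (r powi n)) p)
        = (\<Sum>k\<in>level_index n. ennreal ((r ^ N) powr p))"
      using assms by (simp add: level_index_def n ennreal_powr_ennreal)
    also have "\<dots> = ennreal (2 ^ N * (r ^ N) powr p)"
      using assms by (subst sum_ennreal) (simp_all add: level_index_def n)
    finally show ?thesis
      by (simp add: lp_norm_def ennreal_powr_ennreal)
  qed
  also have "(2 ^ N * (r ^ N) powr p) powr (1 / p) = (2 powr (1 / p) * r) ^ N"
  proof -
    have "(2 ^ N * (r ^ N) powr p) powr (1 / p) = (2 ^ N) powr (1 / p) * r ^ N"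
      using assms by (simp add: powr_mult powr_powr)
    also have "(2 ^ N) powr (1 / p) = (2 powr (1 / p)) ^ N"
      by (simp add: powr_powr powr_power flip: powr_realpow)
    finally show ?thesis
      by (simp add: power_mult_distrib)
  qed
  finally show ?thesis
    using assms by (simp add: n level_energy_def)
qed

text \<open>
  All waves vanish at both endpoints of the unit interval.
\<close>

lemma level_energy_takagi_coarsest:
  assumes "0 < r" and "r < 1"
  shows "level_energy p (takagi r) (-1) = 0"
proof -
  have "takagi r 0 = 0" "takagi r 1 = 0"
    using dist_to_Ints_of_nat[of "2 ^ _"] dist_to_Ints_of_nat[of 0] by (simp_all add: takagi_def)
  then show ?thesis
    by (simp add: level_energy_def schauder_coeff_def)
qed

lemma schauder_tail_takagi:
  assumes "0 < r" and "r < 1" and "0 \<le> n"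
  shows "schauder_tail (takagi r) n = ennreal (1 / (1 - r) * r powi n)"
proof -
  have "ennreal (2 powr (- (real_of_int m / 2))) *
      (SUP k\<in>level_index m. ennreal \<bar>schauder_coeff (takagi r) m k\<bar>) = ennreal (1 * r powi m)"
    if "m \<in> {n..}" for m
  proof -
    have "ennreal (2 powr (- (real_of_int m / 2))) *
        (SUP k\<in>level_index m. ennreal \<bar>schauder_coeff (takagi r) m k\<bar>)
      = (SUP k\<in>level_index m. ennreal (2 powr (- (real_of_int m / 2)) * \<bar>schauder_coeff (takagi r) m k\<bar>))"
      by (simp add: SUP_mult_left_ennreal ennreal_mult)
    also have "\<dots> = (SUP k\<in>level_index m. ennreal (r powi m))"
      using assms that by (intro SUP_cong) (simp_all add: schauder_coeff_takagi)
    also have "\<dots> = ennreal (1 * r powi m)"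
      by (subst cSUP_const) (auto simp: level_index_def lessThan_empty_iff)
    finally show ?thesis .
  qed
  then have "schauder_tail (takagi r) n = (\<Sum>\<^sub>\<infinity>m\<in>{n..}. ennreal (1 * r powi m))"
    unfolding schauder_tail_def by (rule infsum_cong)
  also have "\<dots> = ennreal (1 * r powi n / (1 - r))"
    using assms by (intro infsum_geometric_atLeast) auto
  finally show ?thesis
    by simp
qed

lemma sup_norm_finite:
  assumes "f \<in> C01"
  shows "sup_norm f < \<infinity>"
proof -
  have "compact (f ` {0..1})"
    using assms by (intro compact_continuous_image) (auto simp: C01_def)
  then obtain B where B: "\<forall>y\<in>f ` {0..1}. norm y \<le> B"
    using compact_imp_bounded bounded_iff by metis
  have "sup_norm f \<le> ennreal B"
    unfolding sup_norm_def using B by (intro SUP_least ennreal_leI) auto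
  then show ?thesis
    using le_less_trans ennreal_less_top by fastforce
qed

lemma takagi_in_energy_space:
  assumes "0 < r" and "r < 1" and "1 < p" and "2 powr (1 / p) * r < 1"
  shows "takagi r \<in> energy_space p"
proof -
  let ?\<rho> = "2 powr (1 / p) * r"
  have "lp_norm p {-1..} (\<lambda>n. ennreal (level_energy p (takagi r) n)) < \<infinity>"
  proof (rule lp_norm_geometric_finite[where \<rho> = ?\<rho> and c = 1])
    show "ennreal (level_energy p (takagi r) n) \<le> ennreal (1 * ?\<rho> powi n)" if "-1 \<le> n" for n
      using assms that
      by (cases "n = -1") (simp_all add: level_energy_takagi level_energy_takagi_coarsest)
  qed (use assms in auto)
  moreover have "lp_norm p {0..} (schauder_tail (takagi r)) < \<infinity>"
    by (rule lp_norm_geometric_finite[where \<rho> = r and c = "1 / (1 - r)"])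
      (use assms in \<open>auto simp: schauder_tail_takagi\<close>)
  ultimately show ?thesis
    using assms sup_norm_finite[OF takagi_in_C01[of r]]
    by (auto simp: energy_space_def energy_norm_def takagi_in_C01)
qed

text \<open>
  All energies of nonnegative level are at least \<open>1\<close>, so their \<open>p\<close>-th powers have an infinite sum.
\<close>

lemma takagi_notin_energy_space:
  assumes "0 < r" and "r < 1" and "1 < p" and "1 \<le> 2 powr (1 / p) * r"
  shows "takagi r \<notin> energy_space p"
proof -
  let ?\<zeta> = "\<lambda>n. ennreal_powr (ennreal (level_energy p (takagi r) n)) p"
  have "1 \<le> ?\<zeta> n" if "n \<in> {0..}" for n
  proof -
    have "1 \<le> level_energy p (takagi r) n"
      using assms that by (simp add: level_energy_takagi one_le_power_int)
    then have "ennreal_powr (ennreal 1) p \<le> ?\<zeta> n"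
      using assms by (intro ennreal_powr_mono ennreal_leI) auto
    then show ?thesis
      using ennreal_powr_ennreal[of 1 p] by simp
  qed
  then have "infsum ?\<zeta> {0..} = \<infinity>"
    by (rule infsum_superconst_infinite_ennreal) (auto simp: infinite_Ici)
  moreover have "infsum ?\<zeta> {0..} \<le> infsum ?\<zeta> {-1..}"
    by (rule infsum_mono_neutral) (auto intro!: nonneg_summable_on_complete)
  ultimately have "infsum ?\<zeta> {-1..} = top"
    by (simp add: top_unique)
  then show ?thesis
    by (simp add: energy_space_def energy_norm_def lp_norm_def)
qed

theorem proposition3p21:
  fixes p q :: real
  assumes "1 < p" and "p < q"
  shows "energy_space p \<subset> energy_space q \<and>
    (\<exists>C::real. C > 0 \<and>
      (\<forall>f\<in>energy_space p. energy_norm q f \<le> ennreal C * energy_norm p f))"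
proof -
  \<comment> \<open>The critical ratio: \<open>2\<^bsup>1/s\<^esup>r < 1\<close> holds exactly for \<open>s > p\<close>.\<close>
  define r :: real where "r = 2 powr (- (1 / p))"
  have r: "0 < r" "r < 1"
    using assms by (auto simp: r_def intro!: powr_less_one)
  have product: "2 powr (1 / s) * r = 2 powr (1 / s - 1 / p)" for s :: real
    by (simp add: r_def flip: powr_add)
  have "2 powr (1 / q - 1 / p) < (1::real)"
    using assms by (simp add: powr_less_one frac_less2)
  then have "takagi r \<in> energy_space q" "takagi r \<notin> energy_space p"
    using assms r
    by (auto intro!: takagi_in_energy_space simp: product takagi_notin_energy_space)
  moreover have "f \<in> energy_space q" if "f \<in> energy_space p" for f
  proof -
    have "2 * energy_norm p f < \<infinity>"
      using that by (simp add: energy_space_def ennreal_mult_less_top)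
    then show ?thesis
      using that energy_norm_le[OF assms, of f] by (auto simp: energy_space_def)
  qed
  moreover have "\<forall>f\<in>energy_space p. energy_norm q f \<le> ennreal 2 * energy_norm p f"
    using energy_norm_le[OF assms] by simp
  ultimately show ?thesis
    by (intro conjI psubsetI subsetI exI[of _ 2]) auto
qed

end
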